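(* On the real line $\mathbb{R}^1$, the bound $\|(S_k^+)^*f\|_{L^{1,\infty}}\lesssim(1+k)\|f\|_{L^1}$ for positive dyadic shifts $S_k^+$ of order $k$ is sharp in its dependence on $k$. More precisely: for every $k\in\mathbb{N}=\{0,1,2,\ldots\}$ there exist a collection $\mathscr{K}$ of dyadic intervals that is sparse with constant $\tfrac12$ (independent of $k$) and a nonnegative, not identically zero function $f\in L^1(\mathbb{R})$ such that the adjoint $(S_k^+)^*$ of the shift $S_k^+$ associated with $\mathscr{K}$ satisfies $$\|(S_k^+)^*f\|_{L^{1,\infty}}=(k+1)\|f\|_{L^1}.$$
   Context: $\mathscr{D}$ denotes the standard dyadic intervals $2^{-j}([0,1)+m)$, $j,m\in\mathbb{Z}$. For $K\in\mathscr{D}$ and $k\in\mathbb{N}$, $K^{(k)}$ is the $k$ generations older dyadic ancestor of $K$, i.e. the unique $K^{(k)}\in\mathscr{D}$ with $K\subseteq K^{(k)}$ and $|K^{(k)}|=2^k|K|$ (so $K^{(0)}=K$). A collection $\mathscr{K}\subset\mathscr{D}$ is sparse with constant $c>0$ if there are pairwise disjoint measurable subsets $E(K)\subset K$, $K\in\mathscr{K}$, with $|E(K)|\geq c|K|$ for all $K\in\mathscr{K}$. The positive dyadic shift of order $k$ associated with a sparse collection $\mathscr{K}$, and its adjoint, are $$S_k^+f=\sum_{K\in\mathscr{K}}1_K\,\frac{1}{|K^{(k)}|}\int_{K^{(k)}}f\,\mathrm{d}x,\qquad (S_k^+)^*f=\sum_{K\in\mathscr{K}}\frac{1_{K^{(k)}}}{|K^{(k)}|}\int_K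 f\,\mathrm{d}x.$$ $\|g\|_{L^{1,\infty}}:=\sup_{t>0}t\,|\{|g|>t\}|$. *)

theory Defs
  imports "HOL-Analysis.Analysis"
begin

definition dyadic_interval :: "int \<Rightarrow> int \<Rightarrow> real set" where
  "dyadic_interval j m = (\<lambda>x. 2 powi (- j) * (x + of_int m)) ` {0..<1}"

definition dyadic_intervals :: "real set set" where
  "dyadic_intervals = {dyadic_interval j m | j m. True}"

definition dyadic_ancestor :: "nat \<Rightarrow> real set \<Rightarrow> real set" where
  "dyadic_ancestor k K =
     (THE L. L \<in> dyadic_intervals \<and> K \<subseteq> L \<and> measure lebesgue L = 2 ^ k * measure lebesgue K)"

definition dyadic_sparse :: "real \<Rightarrow> real set set \<Rightarrow> bool" where
  "dyadic_sparse c \<K> \<longleftrightarrow>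
     c > 0 \<and> \<K> \<subseteq> dyadic_intervals \<and>
     (\<exists>E :: real set \<Rightarrow> real set.
        disjoint_family_on E \<K> \<and>
        (\<forall>K\<in>\<K>. E K \<in> sets lebesgue \<and> E K \<subseteq> K \<and>
                measure lebesgue (E K) \<ge> c * measure lebesgue K))"

definition pos_shift :: "nat \<Rightarrow> real set set \<Rightarrow> (real \<Rightarrow> real) \<Rightarrow> real \<Rightarrow> real" where
  "pos_shift k \<K> f x =
     (\<Sum>\<^sub>\<infinity>K\<in>\<K>. indicator K x *
        ((LINT y:dyadic_ancestor k K|lebesgue. f y) / measure lebesgue (dyadic_ancestor k K)))"

definition pos_shift_adj_term ::
    "nat \<Rightarrow> (real \<Rightarrow> real) \<Rightarrow> real \<Rightarrow> real set \<Rightarrow> real" where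
  "pos_shift_adj_term k f x K =
     indicator (dyadic_ancestor k K) x / measure lebesgue (dyadic_ancestor k K) *
       (LINT y:K|lebesgue. f y)"

text \<open>Infinite sums in \<^typ>\<open>real\<close> are \<open>0\<close> when they do not converge. Statements about the
  operator below therefore have to come with almost everywhere summability of its defining series.\<close>

definition pos_shift_adj :: "nat \<Rightarrow> real set set \<Rightarrow> (real \<Rightarrow> real) \<Rightarrow> real \<Rightarrow> real" where
  "pos_shift_adj k \<K> f x = (\<Sum>\<^sub>\<infinity>K\<in>\<K>. pos_shift_adj_term k f x K)"

definition weak_L1_norm :: "(real \<Rightarrow> real) \<Rightarrow> ennreal" where
  "weak_L1_norm g = (SUP t\<in>{0<..}. ennreal t * emeasure lebesgue {x. \<bar>g x\<bar> > t})"

lemma dyadic_interval_eq: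
  "dyadic_interval j m = {2 powi (- j) * of_int m ..< 2 powi (- j) * (of_int m + 1)}"
proof -
  have p: "(2::real) powi (- j) > 0" by simp
  show ?thesis
  proof (intro equalityI subsetI)
    fix y assume "y \<in> dyadic_interval j m"
    then obtain x where x: "0 \<le> x" "x < 1" "y = 2 powi (- j) * (x + of_int m)"
      by (auto simp: dyadic_interval_def)
    then show "y \<in> {2 powi (- j) * of_int m ..< 2 powi (- j) * (of_int m + 1)}"
      using p by (simp only: atLeastLessThan_iff mult_le_cancel_left_pos mult_less_cancel_left_pos) simp
  next
    fix y :: real assume y: "y \<in> {2 powi (- j) * of_int m ..< 2 powi (- j) * (of_int m + 1)}"
    define x where "x = y / 2 powi (- j) - of_int m"
    have yx: "y = 2 powi (- j) * (x + of_int m)" using p by (simp add: x_def)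
    have "0 \<le> x \<and> x < 1" using y p unfolding yx
      by (simp only: atLeastLessThan_iff mult_le_cancel_left_pos mult_less_cancel_left_pos) simp
    then show "y \<in> dyadic_interval j m" unfolding dyadic_interval_def using yx by force
  qed
qed

lemma measure_dyadic_interval: "measure lebesgue (dyadic_interval j m) = 2 powi (- j)"
proof -
  have "2 powi (- j) * of_int m \<le> (2 powi (- j) * (of_int m + 1) :: real)"
    by (intro mult_left_mono) auto
  then show ?thesis
    unfolding dyadic_interval_eq by (simp add: measure_completion distrib_left)
qed

lemma atLeastLessThan_subset_iff':
  fixes a b c d :: real
  assumes "a < b"
  shows "{a..<b} \<subseteq> {c..<d} \<longleftrightarrow> c \<le> a \<and> b \<le> d"
proof
  assume s: "{a..<b} \<subseteq> {c..<d}"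
  have "a \<in> {c..<d}" using s assms by auto
  moreover have "b \<le> d"
  proof (rule ccontr)
    assume "\<not> b \<le> d"
    then have "max a d \<in> {a..<b}" using assms by auto
    then show False using s by auto
  qed
  ultimately show "c \<le> a \<and> b \<le> d" by auto
qed auto

lemma dyadic_interval_subset_iff:
  "dyadic_interval j m \<subseteq> dyadic_interval (j - int k) n \<longleftrightarrow> n = m div 2 ^ k"
proof -
  have p: "(2::real) powi (- j) > 0" by simp
  have e: "(2::real) powi (- (j - int k)) = 2 powi (- j) * 2 ^ k"
    by (simp add: power_int_add[symmetric] flip: power_int_of_nat)
  have "dyadic_interval j m \<subseteq> dyadic_interval (j - int k) n \<longleftrightarrow>
        2 powi (- j) * (2 ^ k * of_int n) \<le> (2 powi (- j) * of_int m :: real) \<and>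
        2 powi (- j) * (of_int m + 1) \<le> (2 powi (- j) * (2 ^ k * (of_int n + 1)) :: real)"
    unfolding dyadic_interval_eq e
    using p by (subst atLeastLessThan_subset_iff') (auto simp: mult.assoc)
  also have "\<dots> \<longleftrightarrow> of_int (2 ^ k * n) \<le> (of_int m :: real) \<and>
                  of_int (m + 1) \<le> (of_int (2 ^ k * (n + 1)) :: real)"
    using p by (simp only: mult_le_cancel_left_pos) simp
  also have "\<dots> \<longleftrightarrow> 2 ^ k * n \<le> m \<and> m < 2 ^ k * (n + 1)"
    by (simp only: of_int_le_iff) auto
  also have "\<dots> \<longleftrightarrow> n = m div 2 ^ k"
  proof -
    have q: "(2::int) ^ k > 0" by simp
    show ?thesis
    proof
      assume a: "2 ^ k * n \<le> m \<and> m < 2 ^ k * (n + 1)"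
      have "m = 2 ^ k * n + (m - 2 ^ k * n)" by simp
      moreover have "0 \<le> m - 2 ^ k * n" "m - 2 ^ k * n < 2 ^ k" using a by (auto simp: algebra_simps)
      ultimately show "n = m div 2 ^ k" by (metis int_div_pos_eq)
    next
      assume n: "n = m div 2 ^ k"
      have "2 ^ k * n + m mod 2 ^ k = m" by (simp add: n)
      moreover have "0 \<le> m mod 2 ^ k" "m mod 2 ^ k < 2 ^ k" using q by auto
      moreover have "2 ^ k * (n + 1) = 2 ^ k * n + 2 ^ k" by (simp add: distrib_left)
      ultimately show "2 ^ k * n \<le> m \<and> m < 2 ^ k * (n + 1)" by linarith
    qed
  qed
  finally show ?thesis .
qed

lemma dyadic_ancestor_unique:
  "(L \<in> dyadic_intervals \<and> dyadic_interval j m \<subseteq> L \<and>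
      measure lebesgue L = 2 ^ k * measure lebesgue (dyadic_interval j m)) \<longleftrightarrow>
   L = dyadic_interval (j - int k) (m div 2 ^ k)"
proof -
  have e: "(2::real) powi (- (j - int k)) = 2 ^ k * 2 powi (- j)"
    by (simp add: power_int_add[symmetric] flip: power_int_of_nat)
  have i: "i = j - int k" if "(2::real) powi (- i) = 2 powi (- (j - int k))" for i
    using that power_int_strict_increasing[of _ _ "2::real"]
    by (metis linorder_neqE less_irrefl neg_less_iff_less one_less_numeral_iff semiring_norm(76))
  show ?thesis (is "?A \<longleftrightarrow> ?B")
  proof
    assume A: ?A
    then obtain i n where L: "L = dyadic_interval i n" by (auto simp: dyadic_intervals_def)
    with A have "i = j - int k" by (intro i) (simp only: measure_dyadic_interval e)
    with A L show ?B by (simp only: dyadic_interval_subset_iff)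
  next
    assume B: ?B
    then show ?A
      by (simp only: measure_dyadic_interval e dyadic_interval_subset_iff)
        (auto simp: dyadic_intervals_def)
  qed
qed

lemma dyadic_ancestor_eq:
  "dyadic_ancestor k (dyadic_interval j m) = dyadic_interval (j - int k) (m div 2 ^ k)"
  unfolding dyadic_ancestor_def dyadic_ancestor_unique by simp

end

theory Submission
  imports Defs
begin

text \<open>
  The sparse collection consists of \<open>2 ^ k\<close> chains of nested intervals, one at each integer
  \<open>m\<close> with \<open>0 \<le> m < 2 ^ k\<close>: the intervals \<open>stem i m = [m, m + 2 ^ (-i))\<close> for
  \<open>0 \<le> i \<le> k\<close>. The right halves of these intervals are pairwise disjoint, which gives
  sparseness with constant one half. The function \<open>spikes k\<close> puts unit mass into the smallest
  interval of every chain, so that each interval of the collection, whatever its length,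
  has integral \<open>1\<close>. This is the gain: within a chain the intervals shrink, but they all see
  the same mass.

  Now fix a level \<open>i\<close>. The \<open>k\<close>-th ancestor of \<open>stem i m\<close> is the dyadic interval of length
  \<open>2 ^ (k - i)\<close> around \<open>m\<close>. Such an interval inside \<open>[0, 2 ^ k)\<close> is the ancestor of
  exactly as many \<open>stem i m\<close> as it contains integers \<open>m\<close>, namely \<open>2 ^ (k - i)\<close>
  (\<open>card_div_block\<close>), and each of them contributes the value \<open>2 ^ (i - k)\<close> there. Hence every
  one of the \<open>k + 1\<close> levels contributes exactly the indicator of \<open>[0, 2 ^ k)\<close>, and the adjoint
  shift of \<open>spikes k\<close> is \<open>k + 1\<close> times this indicator (\<open>pos_shift_adj_stems\<close>). For a multiple of
  an indicator the weak and the strong norm agree, so the weak norm is \<open>(k + 1) * 2 ^ k\<close>, whereas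
  the total mass of \<open>spikes k\<close> is \<open>2 ^ k\<close>.
\<close>

definition stem :: "nat \<Rightarrow> int \<Rightarrow> real set" where
  "stem i m = {of_int m ..< of_int m + 1 / 2 ^ i}"

definition stems :: "nat \<Rightarrow> real set set" where
  "stems k = (\<lambda>(i, m). stem i m) ` ({..k} \<times> {0..<2 ^ k})"

definition spikes :: "nat \<Rightarrow> real \<Rightarrow> real" where
  "spikes k x = (\<Sum>m\<in>{0..<2 ^ k}. 2 ^ k * indicator (stem k m) x)"

lemma stem_dyadic: "stem i m = dyadic_interval (int i) (2 ^ i * m)"
  by (simp add: stem_def dyadic_interval_eq power_int_minus field_simps)

lemma emeasure_stem: "emeasure lebesgue (stem i m) = ennreal (1 / 2 ^ i)"
  by (simp add: stem_def)

lemma measure_stem: "measure lebesgue (stem i m) = 1 / 2 ^ i"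
  using emeasure_stem[of i m] by (simp add: measure_def)

lemma sets_stem [measurable]: "stem i m \<in> sets lebesgue"
  by (simp add: stem_def)

lemma mem_stemD: "x \<in> stem i m \<Longrightarrow> \<lfloor>x\<rfloor> = m"
proof -
  assume x: "x \<in> stem i m"
  have "(1::real) / 2 ^ i \<le> 1" by simp
  then show ?thesis using x unfolding stem_def atLeastLessThan_iff floor_eq_iff by linarith
qed

lemma stem_antimono: "i \<le> j \<Longrightarrow> stem j m \<subseteq> stem i m"
proof -
  assume "i \<le> j"
  then have "(1::real) / 2 ^ j \<le> 1 / 2 ^ i" by (simp add: field_simps power_increasing)
  then show ?thesis unfolding stem_def by auto
qed

lemma inj_stem: "inj_on (\<lambda>(i, m). stem i m) X"
proof (clarsimp simp: inj_on_def)
  fix i j m n assume eq: "stem i m = stem j n"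
  then have "(1::real) / 2 ^ i = 1 / 2 ^ j" by (metis measure_stem)
  then have "i = j" by simp
  moreover have "of_int m \<in> stem i m" by (simp add: stem_def)
  with eq have "m = n" by (metis mem_stemD)
  ultimately show "i = j \<and> m = n" by simp
qed

text \<open>
  The disjoint pieces are the right halves. Intervals at different integers are already disjoint,
  and at a common integer the shorter interval lies in the left half of the longer one.
\<close>

lemma dyadic_sparse_stems: "dyadic_sparse (1/2) (stems k)"
proof -
  \<comment> \<open>the right half of \<open>K\<close>, written without reference to the endpoints\<close>
  define E where "E K = {x \<in> K. x - measure lebesgue K / 2 \<in> K}" for K :: "real set"
  have E: "E (stem i m) = {of_int m + 1 / 2 ^ Suc i ..< of_int m + 1 / 2 ^ i}" for i m
  proof -
    have "(1::real) / 2 ^ i > 0" by simp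
    then show ?thesis unfolding E_def measure_stem by (auto simp: stem_def)
  qed
  have EK: "E K \<subseteq> K" for K by (auto simp: E_def)
  have "measure lebesgue (E (stem i m)) = 1 / 2 * measure lebesgue (stem i m)" for i m
    unfolding measure_stem E
    by (subst measure_completion) (auto simp: field_simps)
  moreover have "E (stem i m) \<in> sets lebesgue" for i m by (simp add: E)
  moreover have disj: "E (stem i m) \<inter> E (stem j n) = {}" if "i < j" for i j m n
  proof (rule ccontr)
    assume "E (stem i m) \<inter> E (stem j n) \<noteq> {}"
    then obtain x where x: "x \<in> E (stem i m)" "x \<in> E (stem j n)" by auto
    with EK have "x \<in> stem i m" "x \<in> stem j n" by blast+
    then have "m = n" using mem_stemD by blast
    moreover have "x \<in> stem (Suc i) n"
      using stem_antimono[of "Suc i" j n] that \<open>x \<in> stem j n\<close> by auto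
    ultimately show False using x(1) unfolding E by (simp add: stem_def)
  qed
  have "E (stem i m) \<inter> E (stem j n) = {}" if "(i, m) \<noteq> (j, n)" for i j m n
  proof (cases "i = j")
    case True
    with that have "stem i m \<inter> stem j n = {}" using mem_stemD by blast
    with EK show ?thesis by blast
  next
    case False
    with disj[of i j m n] disj[of j i n m] show ?thesis by (metis Int_commute linorder_neqE_nat)
  qed
  then have "E K \<inter> E L = {}" if "K \<in> stems k" "L \<in> stems k" "K \<noteq> L" for K L
    using that unfolding stems_def by (elim imageE) (metis case_prod_conv surj_pair)
  then have "disjoint_family_on E (stems k)"
    by (simp add: disjoint_family_on_def)
  moreover have "stems k \<subseteq> dyadic_intervals"
    by (auto simp: stems_def stem_dyadic dyadic_intervals_def)
  ultimately show ?thesis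
    unfolding dyadic_sparse_def using EK
    by (intro conjI exI[of _ E]) (auto simp: stems_def)
qed

lemma spikes_nonneg: "spikes k x \<ge> 0"
  unfolding spikes_def by (intro sum_nonneg) auto

lemma integrable_stem: "integrable lebesgue (indicator (stem i m) :: real \<Rightarrow> real)"
  by (intro integrable_real_indicator) (auto simp: emeasure_stem)

lemma integrable_spikes: "integrable lebesgue (spikes k)"
  unfolding spikes_def by (intro Bochner_Integration.integrable_sum integrable_mult_right integrable_stem)

text \<open>
  The value does not depend on \<open>i\<close>, because all the mass near \<open>m\<close> sits in \<open>stem k m\<close>,
  which every \<open>stem i m\<close> contains.
\<close>

lemma integral_stem_spikes:
  assumes "i \<le> k" "0 \<le> m" "m < 2 ^ k"
  shows "(LINT y:stem i m|lebesgue. spikes k y) = 1"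
proof -
  have "indicator (stem i m) y *\<^sub>R spikes k y = 2 ^ k * indicator (stem k m) y" for y
  proof -
    have "indicator (stem i m) y *\<^sub>R spikes k y =
        (\<Sum>n\<in>{0..<2 ^ k}. if n = m then 2 ^ k * indicator (stem k m) y else 0)"
      unfolding spikes_def scaleR_sum_right
      using stem_antimono[OF assms(1)]
      by (intro sum.cong refl) (auto simp: indicator_def dest: mem_stemD)
    then show ?thesis using assms by simp
  qed
  then show ?thesis
    by (simp add: set_lebesgue_integral_def measure_stem)
qed

lemma nn_integral_spikes: "(\<integral>\<^sup>+ x. ennreal \<bar>spikes k x\<bar> \<partial>lebesgue) = ennreal (2 ^ k)"
proof -
  have "(LINT x|lebesgue. spikes k x) = 2 ^ k"
    unfolding spikes_def
    by (subst Bochner_Integration.integral_sum) (auto intro!: integrable_stem simp: measure_stem)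
  then show ?thesis
    using nn_integral_eq_integral[OF integrable_spikes[of k]] by (simp add: spikes_nonneg)
qed

text \<open>
  As the ancestor has length \<open>2 ^ (k - i) \<ge> 1\<close>, its endpoints are integers and membership
  depends on the integer part only. This turns the evaluation of the shift into counting integers.
\<close>

lemma stem_ancestor:
  assumes "i \<le> k"
  shows "x \<in> dyadic_ancestor k (stem i m) \<longleftrightarrow> \<lfloor>x\<rfloor> div 2 ^ (k - i) = m div 2 ^ (k - i)"
    and "measure lebesgue (dyadic_ancestor k (stem i m)) = 2 ^ (k - i)"
proof -
  define d where "d = k - i"
  have k: "k = i + d" using assms by (simp add: d_def)
  have anc: "dyadic_ancestor k (stem i m) = dyadic_interval (- int d) (m div 2 ^ d)"
    by (simp add: stem_dyadic dyadic_ancestor_eq k power_add)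
  have "x \<in> dyadic_interval (- int d) n \<longleftrightarrow> \<lfloor>x\<rfloor> div 2 ^ d = n" for x n
  proof -
    have "x \<in> dyadic_interval (- int d) n \<longleftrightarrow> of_int n \<le> x / 2 ^ d \<and> x / 2 ^ d < of_int n + 1"
      by (simp add: dyadic_interval_eq field_simps)
    also have "\<dots> \<longleftrightarrow> \<lfloor>x / 2 ^ d\<rfloor> = n" by (simp add: floor_eq_iff)
    also have "\<lfloor>x / 2 ^ d\<rfloor> = \<lfloor>x\<rfloor> div 2 ^ d"
      using floor_divide_real_eq_div[of "2 ^ d" x] by simp
    finally show ?thesis .
  qed
  then show "x \<in> dyadic_ancestor k (stem i m) \<longleftrightarrow> \<lfloor>x\<rfloor> div 2 ^ (k - i) = m div 2 ^ (k - i)"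
    unfolding anc d_def[symmetric] by auto
  show "measure lebesgue (dyadic_ancestor k (stem i m)) = 2 ^ (k - i)"
    unfolding anc d_def[symmetric] measure_dyadic_interval by simp
qed

lemma div_less_iff_block:
  fixes a p c :: int
  assumes "p > 0"
  shows "a div p < c \<longleftrightarrow> a < c * p"
proof -
  have "a div p < c \<longleftrightarrow> of_int a / of_int p < (of_int c :: real)"
    by (simp only: floor_divide_of_int_eq[where 'a = real, symmetric] floor_less_iff)
  also have "\<dots> \<longleftrightarrow> of_int a < (of_int (c * p) :: real)"
    using assms by (simp add: pos_divide_less_eq)
  finally show ?thesis by (simp only: of_int_less_iff)
qed

lemma div_eq_iff_block:
  fixes a p q :: int
  assumes "p > 0"
  shows "a div p = q \<longleftrightarrow> a \<in> {q * p..<(q + 1) * p}"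
  using div_less_iff_block[OF assms, of a q] div_less_iff_block[OF assms, of a "q + 1"]
  by auto

lemma card_div_block:
  fixes a :: int
  shows "card {m \<in> {0..<2 ^ (d + i)}. a div 2 ^ d = m div 2 ^ d} =
    (if a \<in> {0..<2 ^ (d + i)} then 2 ^ d else 0)"
proof -
  define q where "q = a div 2 ^ d"
  have block: "n div 2 ^ d = q \<longleftrightarrow> n \<in> {q * 2 ^ d..<(q + 1) * 2 ^ d}" for n
    by (simp add: div_eq_iff_block)
  have range: "n \<in> {0..<2 ^ (d + i)} \<longleftrightarrow> n div 2 ^ d \<in> {0..<2 ^ i}" for n :: int
  proof -
    have "n div 2 ^ d < 2 ^ i \<longleftrightarrow> n < 2 ^ i * 2 ^ d"
      using div_less_iff_block[of "2 ^ d" n "2 ^ i"] by simp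
    then show ?thesis by (simp add: pos_imp_zdiv_nonneg_iff power_add mult.commute)
  qed
  have "{m \<in> {0..<2 ^ (d + i)}. a div 2 ^ d = m div 2 ^ d} =
      (if a \<in> {0..<2 ^ (d + i)} then {q * 2 ^ d..<(q + 1) * 2 ^ d} else {})"
  proof -
    have "m \<in> {0..<2 ^ (d + i)} \<and> a div 2 ^ d = m div 2 ^ d \<longleftrightarrow>
        a \<in> {0..<2 ^ (d + i)} \<and> m \<in> {q * 2 ^ d..<(q + 1) * 2 ^ d}" for m
      unfolding range[of m] range[of a] block[of m, symmetric] unfolding q_def by auto
    then have "{m \<in> {0..<2 ^ (d + i)}. a div 2 ^ d = m div 2 ^ d} =
        {m. a \<in> {0..<2 ^ (d + i)} \<and> m \<in> {q * 2 ^ d..<(q + 1) * 2 ^ d}}"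
      by (intro Collect_cong)
    then show ?thesis by (cases "a \<in> {0..<2 ^ (d + i)}") (simp_all del: atLeastLessThan_iff)
  qed
  then show ?thesis by (simp add: algebra_simps nat_power_eq)
qed

lemma pos_shift_adj_stems:
  "pos_shift_adj k (stems k) (spikes k) x = (real k + 1) * indicator {0..<2 ^ k} x"
proof -
  have x: "x \<in> {0..<2 ^ k} \<longleftrightarrow> \<lfloor>x\<rfloor> \<in> {0..<2 ^ k}"
    using floor_less_iff[of x "2 ^ k"] by auto
  have level: "(\<Sum>m\<in>{0..<2 ^ k}. pos_shift_adj_term k (spikes k) x (stem i m)) =
      indicator {0..<2 ^ k} x" if "i \<le> k" for i
  proof -
    have "(\<Sum>m\<in>{0..<2 ^ k}. pos_shift_adj_term k (spikes k) x (stem i m)) =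
        (\<Sum>m\<in>{0..<2 ^ k}. if \<lfloor>x\<rfloor> div 2 ^ (k - i) = m div 2 ^ (k - i) then 1 / 2 ^ (k - i) else 0)"
      using that unfolding pos_shift_adj_term_def
      by (intro sum.cong refl)
        (auto simp: indicator_def stem_ancestor integral_stem_spikes)
    also have "\<dots> = real (card {m \<in> {0..<2 ^ k}. \<lfloor>x\<rfloor> div 2 ^ (k - i) = m div 2 ^ (k - i)}) / 2 ^ (k - i)"
      by (subst sum.inter_filter[symmetric]) auto
    also have "\<dots> = indicator {0..<2 ^ k} x"
      using card_div_block[of "k - i" i "\<lfloor>x\<rfloor>"] that x by (simp add: indicator_def)
    finally show ?thesis .
  qed
  have "pos_shift_adj k (stems k) (spikes k) x =
      (\<Sum>K\<in>stems k. pos_shift_adj_term k (spikes k) x K)"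
    unfolding pos_shift_adj_def by (intro infsum_finite) (simp add: stems_def)
  also have "\<dots> = (\<Sum>(i, m)\<in>{..k} \<times> {0..<2 ^ k}. pos_shift_adj_term k (spikes k) x (stem i m))"
    unfolding stems_def by (subst sum.reindex[OF inj_stem]) (auto intro!: sum.cong)
  also have "\<dots> = (\<Sum>i\<le>k. \<Sum>m\<in>{0..<2 ^ k}. pos_shift_adj_term k (spikes k) x (stem i m))"
    by (rule sum.cartesian_product[symmetric])
  also have "\<dots> = (\<Sum>i\<le>k. indicator {0..<2 ^ k} x)"
    by (intro sum.cong refl level) auto
  finally show ?thesis by (simp add: algebra_simps)
qed

text \<open>
  All levels \<open>t < c\<close> cut out the same set \<open>A\<close>, so the supremum is the limit as \<open>t\<close>
  increases to \<open>c\<close>.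
\<close>

lemma weak_L1_norm_indicator:
  assumes "c \<ge> 0" "emeasure lebesgue A = ennreal a" "a \<ge> 0"
  shows "weak_L1_norm (\<lambda>x. c * indicator A x) = ennreal (c * a)"
proof (rule antisym)
  have level: "{x. \<bar>c * indicator A x\<bar> > t} = (if t < c then A else {})" if "t > 0" for t
    using that assms(1) by (auto simp: indicator_def)
  show "weak_L1_norm (\<lambda>x. c * indicator A x) \<le> ennreal (c * a)"
    unfolding weak_L1_norm_def
  proof (intro SUP_least)
    fix t :: real assume "t \<in> {0<..}"
    then show "ennreal t * emeasure lebesgue {x. \<bar>c * indicator A x\<bar> > t} \<le> ennreal (c * a)"
      using assms
      by (simp only: greaterThan_iff level)
        (auto simp: ennreal_mult'[symmetric] intro!: ennreal_leI mult_right_mono)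
  qed
  show "ennreal (c * a) \<le> weak_L1_norm (\<lambda>x. c * indicator A x)" (is "_ \<le> ?W")
  proof (cases "c = 0 \<or> ?W = top")
    case False
    then obtain w where w: "?W = ennreal w" "w \<ge> 0" by (cases ?W) auto
    have "z * (c * a) \<le> w" if "0 < z" "z < 1" for z
    proof -
      have "0 < z * c" "z * c < c" using that False assms(1) by auto
      then have "ennreal (z * c) * ennreal a \<le> ?W"
        unfolding weak_L1_norm_def assms(2)[symmetric]
        by (intro SUP_upper2[of "z * c"])
          (simp_all only: level greaterThan_iff if_True order_refl)
      then show ?thesis using w \<open>0 < z * c\<close> assms(3) by (simp add: ennreal_mult'[symmetric] mult.assoc)
    qed
    then show ?thesis unfolding w(1) by (metis ennreal_leI field_le_mult_one_interval)
  qed auto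
qed

theorem mainTheorem2:
  fixes k :: nat
  shows "\<exists>(\<K> :: real set set) (f :: real \<Rightarrow> real).
           dyadic_sparse (1/2) \<K> \<and>
           integrable lebesgue f \<and> (\<forall>x. f x \<ge> 0) \<and> \<not> (AE x in lebesgue. f x = 0) \<and>
           (AE x in lebesgue. pos_shift_adj_term k f x summable_on \<K>) \<and>
           weak_L1_norm (pos_shift_adj k \<K> f) =
             ennreal (real k + 1) * (\<integral>\<^sup>+ x. ennreal \<bar>f x\<bar> \<partial>lebesgue)"
proof (intro exI conjI)
  show "dyadic_sparse (1/2) (stems k)" by (rule dyadic_sparse_stems)
  show "integrable lebesgue (spikes k)" by (rule integrable_spikes)
  show "\<forall>x. spikes k x \<ge> 0" by (simp add: spikes_nonneg)
  show "\<not> (AE x in lebesgue. spikes k x = 0)"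
  proof
    assume "AE x in lebesgue. spikes k x = 0"
    then have "AE x in lebesgue. ennreal \<bar>spikes k x\<bar> = 0" by (auto elim: eventually_mono)
    then have "(\<integral>\<^sup>+ x. ennreal \<bar>spikes k x\<bar> \<partial>lebesgue) = (\<integral>\<^sup>+ x. 0 \<partial>(lebesgue :: real measure))"
      by (intro nn_integral_cong_AE)
    then show False by (simp add: nn_integral_spikes)
  qed
  show "AE x in lebesgue. pos_shift_adj_term k (spikes k) x summable_on stems k"
    by (simp add: stems_def)
  have "weak_L1_norm (pos_shift_adj k (stems k) (spikes k)) = ennreal ((real k + 1) * 2 ^ k)"
    unfolding pos_shift_adj_stems[abs_def] by (intro weak_L1_norm_indicator) auto
  then show "weak_L1_norm (pos_shift_adj k (stems k) (spikes k)) =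
      ennreal (real k + 1) * (\<integral>\<^sup>+ x. ennreal \<bar>spikes k x\<bar> \<partial>lebesgue)"
    by (simp add: nn_integral_spikes ennreal_mult)
qed

end
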